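(* The Bing space $\mathbb{B}$ is $n$-homogeneous for every positive integer $n$.
   Context: The Bing space $\mathbb{B}$ is the set $\{(x,y)\in\mathbb{Q}\times\mathbb{Q}: y\ge 0\}$ endowed with the topology consisting of all sets $U\subset\mathbb{B}$ such that for every $(a,b)\in U$ there exists $\varepsilon>0$ with $$\{(x,0)\in\mathbb{B}:|x-(a-b/\sqrt{3})|<\varepsilon\}\cup\{(x,0)\in\mathbb{B}:|x-(a+b/\sqrt{3})|<\varepsilon\}\subset U.$$ A topological space $X$ is $n$-homogeneous, for a positive integer $n$, if any bijection $f:A\to B$ between $n$-element subsets $A,B$ of $X$ can be extended to a homeomorphism of $X$ onto itself. *)

theory Defs
  imports "HOL-Analysis.Analysis"
begin

definition bing_set :: "(rat \<times> rat) set" where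
  "bing_set = {(x, y). y \<ge> 0}"

text \<open>The points \<open>(x, 0)\<close> of the Bing space, with \<open>x\<close> rational, at distance less than
  \<open>e\<close> from a real number \<open>c\<close>.\<close>

definition bing_base_interval :: "real \<Rightarrow> real \<Rightarrow> (rat \<times> rat) set" where
  "bing_base_interval c e = {(x, y) \<in> bing_set. y = 0 \<and> \<bar>real_of_rat x - c\<bar> < e}"

definition bing_open :: "(rat \<times> rat) set \<Rightarrow> bool" where
  "bing_open U \<longleftrightarrow> U \<subseteq> bing_set \<and>
     (\<forall>(a, b) \<in> U. \<exists>e>0.
        bing_base_interval (real_of_rat a - real_of_rat b / sqrt 3) e \<union>
        bing_base_interval (real_of_rat a + real_of_rat b / sqrt 3) e \<subseteq> U)"

definition bing_space :: "(rat \<times> rat) topology" where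
  "bing_space = topology bing_open"

lemma bing_base_interval_mono:
  "d \<le> e \<Longrightarrow> bing_base_interval c d \<subseteq> bing_base_interval c e"
  by (auto simp: bing_base_interval_def)

lemma istopology_bing_open: "istopology bing_open"
  unfolding istopology_def
proof (intro conjI allI impI)
  fix S T assume S: "bing_open S" and T: "bing_open T"
  show "bing_open (S \<inter> T)"
    unfolding bing_open_def
  proof (intro conjI ballI, goal_cases)
    case 1
    show ?case using S by (auto simp: bing_open_def)
  next
    case (2 p)
    obtain a b where p: "p = (a, b)" by (cases p)
    let ?N = "\<lambda>e. bing_base_interval (real_of_rat a - real_of_rat b / sqrt 3) e \<union>
        bing_base_interval (real_of_rat a + real_of_rat b / sqrt 3) e"
    obtain d where d: "d > 0" "?N d \<subseteq> S"
      using S 2 p unfolding bing_open_def by blast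
    obtain e where e: "e > 0" "?N e \<subseteq> T"
      using T 2 p unfolding bing_open_def by blast
    have "?N (min d e) \<subseteq> ?N d" "?N (min d e) \<subseteq> ?N e"
      by (intro Un_mono bing_base_interval_mono; simp)+
    then have "?N (min d e) \<subseteq> S \<inter> T" "min d e > 0"
      using d e by auto
    then show ?case unfolding p by blast
  qed
next
  fix K assume K: "\<forall>S\<in>K. bing_open S"
  show "bing_open (\<Union>K)"
    unfolding bing_open_def
  proof (intro conjI ballI, goal_cases)
    case 1
    show ?case using K by (auto simp: bing_open_def)
  next
    case (2 p)
    obtain a b where p: "p = (a, b)" by (cases p)
    obtain S where S: "S \<in> K" "p \<in> S" using 2 by blast
    then obtain e where "e > 0"
      "bing_base_interval (real_of_rat a - real_of_rat b / sqrt 3) e \<union>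
       bing_base_interval (real_of_rat a + real_of_rat b / sqrt 3) e \<subseteq> S"
      using K p unfolding bing_open_def by blast
    then show ?case unfolding p using S by blast
  qed
qed

lemma openin_bing_space: "openin bing_space U \<longleftrightarrow> bing_open U"
  by (simp add: bing_space_def istopology_bing_open topology_inverse')

lemma topspace_bing_space: "topspace bing_space = bing_set"
proof
  show "topspace bing_space \<subseteq> bing_set"
    using openin_topspace[of bing_space] unfolding openin_bing_space bing_open_def by (rule conjunct1)
  have "bing_open bing_set"
    unfolding bing_open_def
    by (auto simp: bing_base_interval_def intro!: exI[of _ "1::real"])
  then show "bing_set \<subseteq> topspace bing_space"
    by (simp add: openin_subset openin_bing_space)
qed

text \<open>The notion is meant for \<open>n > 0\<close>; the finiteness conditions, which are then
  redundant, only exclude infinite sets, whose \<open>card\<close> is \<open>0\<close>.\<close>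

definition n_homogeneous :: "nat \<Rightarrow> 'a topology \<Rightarrow> bool" where
  "n_homogeneous n X \<longleftrightarrow>
     (\<forall>A B f. A \<subseteq> topspace X \<and> B \<subseteq> topspace X \<and>
        finite A \<and> card A = n \<and> finite B \<and> card B = n \<and> bij_betw f A B \<longrightarrow>
        (\<exists>h. homeomorphic_map X X h \<and> (\<forall>x\<in>A. h x = f x)))"

end

theory Submission
  imports Defs "HOL-Computational_Algebra.Nth_Powers"
begin

text \<open>
  A point \<open>(x, y)\<close> is the pair of conjugate elements \<open>x \<plusminus> y / sqrt 3\<close> of \<open>\<rat>(sqrt 3)\<close>, its two feet,
  so the Bing space is the quotient of \<open>\<rat>(sqrt 3)\<close> by conjugation, in which only the rational
  points carry open sets. Removing a finite set \<open>A\<close> cuts the remaining line into open sets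
  \<open>U (a, m)\<close> that shrink to the feet of \<open>a \<in> A\<close> as \<open>m \<rightarrow> \<infinity>\<close>, with end points outside
  \<open>\<rat>(sqrt 3)\<close>. Whether \<open>a\<close> has one foot or two is invisible from this decomposition.
  Since conjugation is generic (the pairs \<open>(z, conjugate of z)\<close> are dense in the plane), a
  back-and-forth argument yields a bijection between the remaining points for \<open>A\<close> and for \<open>f(A)\<close>
  that commutes with conjugation, sends \<open>U (a, m)\<close> to \<open>V (f a, m)\<close> and preserves the order
  within each of these sets; together with \<open>f\<close> it induces the required homeomorphism.
\<close>

section \<open>Feet in \<rat>(sqrt 3), conjugation and density\<close>

text \<open>Negative second coordinates are included, so \<open>foot\<close> identifies all of
  \<rat> \<times> \<rat> with \<rat>(sqrt 3); the left foot of a point of the Bing space is the foot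
  of its \<open>reflect\<close>.\<close>

definition foot :: "rat \<times> rat \<Rightarrow> real" where
  "foot z = real_of_rat (fst z) + real_of_rat (snd z) / sqrt 3"

text \<open>Conjugation of \<rat>(sqrt 3), read through \<open>foot\<close>; its fixed points are
  the rational points on the axis.\<close>

definition reflect :: "rat \<times> rat \<Rightarrow> rat \<times> rat" where
  "reflect z = (fst z, - snd z)"

text \<open>The point of the Bing space represented by \<open>z\<close> and by \<open>reflect z\<close>.\<close>

definition upper :: "rat \<times> rat \<Rightarrow> rat \<times> rat" where
  "upper z = (fst z, \<bar>snd z\<bar>)"

lemma reflect_reflect [simp]: "reflect (reflect z) = z"
  by (simp add: reflect_def)

lemma reflect_eq_iff [simp]: "reflect z = reflect w \<longleftrightarrow> z = w"
  by (metis reflect_reflect)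

lemma upper_reflect [simp]: "upper (reflect z) = upper z"
  by (simp add: upper_def reflect_def)

lemma upper_cases: "upper z = z \<or> upper z = reflect z"
  by (cases z) (auto simp: upper_def reflect_def)

lemma upper_eq_iff: "upper z = upper w \<longleftrightarrow> z = w \<or> z = reflect w"
  by (cases z; cases w) (auto simp: upper_def reflect_def abs_if split: if_splits)

lemma upper_in_bing_set [simp]: "upper z \<in> bing_set"
  by (simp add: upper_def bing_set_def)

lemma upper_bing_set: "z \<in> bing_set \<Longrightarrow> upper z = z"
  by (cases z) (auto simp: upper_def bing_set_def)

text \<open>If m squared is 3 times n squared, cancelling the square of n makes \<open>3 ^ 1\<close>
  a square, but a prime occurs in a square with even exponent.\<close>

lemma sqrt_3_irrational: "sqrt 3 \<notin> \<rat>"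
proof
  assume "sqrt 3 \<in> \<rat>"
  then obtain m n :: nat where n: "n \<noteq> 0" and "\<bar>sqrt 3\<bar> = m / n"
    by (rule Rats_abs_nat_div_natE)
  then have "real m = sqrt 3 * n" by (simp add: field_simps)
  then have "(real m)\<^sup>2 = 3 * (real n)\<^sup>2" by (simp add: power_mult_distrib)
  then have "m ^ 2 = 3 ^ 1 * n ^ 2" by (metis of_nat_eq_iff of_nat_mult of_nat_numeral of_nat_power power_one_right)
  then have "is_nth_power 2 (3 ^ 1 * n ^ 2)" by (metis is_nth_power_nth_power)
  then have "is_nth_power 2 ((3::nat) ^ 1)"
    using is_nth_power_mult_cancel_right[of 2 "n ^ 2" "3 ^ 1"] n by simp
  then show False
    using is_nth_power_prime_power_nat_iff[of "3::nat" 2 1] by simp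
qed

text \<open>1 and 1 / sqrt 3 are linearly independent over \<rat>: distinct first coordinates would
  exhibit sqrt 3 as a quotient of rationals.\<close>

lemma inj_foot: "inj foot"
proof (rule injI)
  fix z w assume eq: "foot z = foot w"
  obtain a b c d where z: "z = (a, b)" and w: "w = (c, d)"
    by (cases z; cases w)
  have eq': "real_of_rat (a - c) * sqrt 3 = real_of_rat (d - b)"
    using eq by (simp add: foot_def z w of_rat_diff field_simps)
  have "a = c"
  proof (rule ccontr)
    assume "a \<noteq> c"
    then have "sqrt 3 = real_of_rat ((d - b) / (a - c))"
      using eq' by (simp add: of_rat_divide field_simps)
    then show False
      using sqrt_3_irrational by (metis Rats_of_rat)
  qed
  with eq' show "z = w" by (simp add: z w)
qed

lemma foot_eq_iff [simp]: "foot z = foot w \<longleftrightarrow> z = w"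
  using inj_foot by (auto dest: injD)

lemma foot_rational_between:
  assumes "l < u"
  obtains w where "reflect w = w" "l < foot w" "foot w < u"
proof -
  obtain q where "l < real_of_rat q" "real_of_rat q < u"
    using of_rat_dense[OF assms] by blast
  then show thesis
    using that[of "(q, 0)"] by (simp add: reflect_def foot_def)
qed

text \<open>Pairs of conjugates are dense in the plane: a rational approximates the mean of the two
  target values, a rational multiple of 1 / sqrt 3 approximates half their difference.\<close>

lemma foot_pair_between:
  assumes "l < u" "l' < u'"
  obtains w where "l < foot w" "foot w < u" "l' < foot (reflect w)" "foot (reflect w) < u'"
proof -
  \<comment> \<open>Each foot carries two errors below \<open>e\<close>, and 2 * \<open>e\<close> is
    at most half the length of either interval.\<close>
  define x y e where "x = (l + u) / 2" and "y = (l' + u') / 2"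
    and "e = min (u - l) (u' - l') / 4"
  have e: "0 < e" "2 * e \<le> u - x" "2 * e \<le> x - l" "2 * e \<le> u' - y" "2 * e \<le> y - l'"
    using assms by (auto simp: x_def y_def e_def field_simps min_def)
  obtain a where a: "(x + y) / 2 - e < real_of_rat a" "real_of_rat a < (x + y) / 2 + e"
    using of_rat_dense[of "(x + y) / 2 - e" "(x + y) / 2 + e"] e(1) by auto
  obtain b where b: "sqrt 3 * ((x - y) / 2 - e) < real_of_rat b"
      "real_of_rat b < sqrt 3 * ((x - y) / 2 + e)"
    using of_rat_dense[of "sqrt 3 * ((x - y) / 2 - e)" "sqrt 3 * ((x - y) / 2 + e)"] e(1)
    by auto
  define t where "t = real_of_rat b / sqrt 3"
  have "(x - y) / 2 - e < t" "t < (x - y) / 2 + e"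
    using b by (simp_all add: t_def pos_less_divide_eq pos_divide_less_eq mult.commute)
  moreover have "foot (a, b) = real_of_rat a + t" "foot (reflect (a, b)) = real_of_rat a - t"
    by (simp_all add: foot_def reflect_def of_rat_minus t_def)
  ultimately have "l < foot (a, b) \<and> foot (a, b) < u \<and>
      l' < foot (reflect (a, b)) \<and> foot (reflect (a, b)) < u'"
    using a e by (simp add: field_simps)
  then show thesis using that by blast
qed

section \<open>Finite partial isomorphisms and their extension\<close>

text \<open>\<open>U\<close> may be disconnected, so the space between \<open>F\<close> and
  \<open>G\<close> need not lie in \<open>U\<close>. Openness at \<open>Max F\<close>, or at
  \<open>Min G\<close> if \<open>F\<close> is empty, supplies an interval right next to that point
  which stays inside \<open>U\<close>.\<close>

lemma gap_in_open_set:
  fixes U :: "real set"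
  assumes U: "open U" "U \<noteq> {}" and F: "finite F" "F \<subseteq> U" and G: "finite G" "G \<subseteq> U"
    and less: "\<And>f g. f \<in> F \<Longrightarrow> g \<in> G \<Longrightarrow> f < g"
  obtains l u where "l < u" "{l<..<u} \<subseteq> U"
    "\<And>x f. x \<in> {l<..<u} \<Longrightarrow> f \<in> F \<Longrightarrow> f < x"
    "\<And>x g. x \<in> {l<..<u} \<Longrightarrow> g \<in> G \<Longrightarrow> x < g"
proof (cases "F = {}")
  case False
  then have M: "Max F \<in> F" "\<And>f. f \<in> F \<Longrightarrow> f \<le> Max F"
    using F by auto
  then obtain e where e: "e > 0" "ball (Max F) e \<subseteq> U"
    using U(1) F(2) unfolding open_contains_ball by blast
  define u where "u = Min (insert (Max F + e) G)"
  have u: "u \<le> Max F + e" "\<And>g. g \<in> G \<Longrightarrow> u \<le> g"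
    using G by (auto simp: u_def)
  have "Max F < u"
    using G(1) e(1) less[OF M(1)] by (simp add: u_def)
  moreover have "{Max F<..<u} \<subseteq> U"
    using e u by (auto simp: dist_real_def subset_eq)
  ultimately show thesis
  proof (rule that)
    fix x f assume "x \<in> {Max F<..<u}" "f \<in> F"
    then show "f < x" using M(2)[of f] by simp
  next
    fix x g assume "x \<in> {Max F<..<u}" "g \<in> G"
    then show "x < g" using u(2)[of g] by simp
  qed
next
  case True
  show thesis
  proof (cases "G = {}")
    case False
    then have M: "Min G \<in> G" "\<And>g. g \<in> G \<Longrightarrow> Min G \<le> g"
      using G by auto
    then obtain e where e: "e > 0" "ball (Min G) e \<subseteq> U"
      using U(1) G(2) unfolding open_contains_ball by blast
    then have "{Min G - e<..<Min G} \<subseteq> U"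
      by (auto simp: dist_real_def subset_eq)
    then show thesis
    proof (rule that[rotated])
      fix x g assume "x \<in> {Min G - e<..<Min G}" "g \<in> G"
      then show "x < g" using M(2)[of g] by simp
    qed (use e True in auto)
  next
    case G: True
    obtain x e where "e > 0" "ball x e \<subseteq> U"
      using U unfolding open_contains_ball by blast
    then have "x - e < x + e" "{x - e<..<x + e} \<subseteq> U"
      by (auto simp: ball_eq_greaterThanLessThan)
    then show thesis
      by (rule that) (use True G in auto)
  qed
qed

text \<open>Order is compared only inside one label, so regions with different labels may be
  rearranged freely. Single-valuedness of \<open>R\<close> is a consequence of the order
  clause.\<close>

definition partial_iso ::
  "('i \<Rightarrow> real set) \<Rightarrow> ('i \<Rightarrow> real set) \<Rightarrow> ((rat \<times> rat) \<times> (rat \<times> rat)) set \<Rightarrow> bool" where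
  "partial_iso U V R \<longleftrightarrow>
     (\<forall>z w. (z, w) \<in> R \<longrightarrow> (reflect z, reflect w) \<in> R) \<and>
     (\<forall>z w. (z, w) \<in> R \<longrightarrow> (\<exists>i. foot z \<in> U i \<and> foot w \<in> V i)) \<and>
     (\<forall>z w z' w' i. (z, w) \<in> R \<longrightarrow> (z', w') \<in> R \<longrightarrow> foot z \<in> U i \<longrightarrow> foot z' \<in> U i \<longrightarrow>
        (foot z < foot z' \<longleftrightarrow> foot w < foot w'))"

text \<open>Equal emptiness guarantees room for images under every label that occurs; the positions
  of \<open>U i\<close> and \<open>V i\<close> are otherwise unrelated. The symmetry in
  \<open>U\<close> and \<open>V\<close> lets one extension result serve both directions.\<close>

locale label_pair =
  fixes U V :: "'i \<Rightarrow> real set"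
  assumes open_U: "open (U i)" and open_V: "open (V i)"
    and disjoint_U: "x \<in> U i \<Longrightarrow> x \<in> U j \<Longrightarrow> i = j"
    and disjoint_V: "x \<in> V i \<Longrightarrow> x \<in> V j \<Longrightarrow> i = j"
    and empty_iff: "U i = {} \<longleftrightarrow> V i = {}"
begin

lemma swap: "label_pair V U"
  by unfold_locales (use open_U open_V disjoint_U disjoint_V empty_iff in auto)

text \<open>The order clause mentions labels on the left only, but the sets \<open>V i\<close> are
  disjoint, so the label of an image determines that of its preimage.\<close>

lemma partial_iso_converse:
  assumes R: "partial_iso U V R"
  shows "partial_iso V U (R\<inverse>)"
proof -
  have U: "\<exists>i. foot w \<in> V i \<and> foot z \<in> U i" if "(z, w) \<in> R" for z w
    using R that unfolding partial_iso_def by blast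
  have "foot w < foot w' \<longleftrightarrow> foot z < foot z'"
    if "(z, w) \<in> R" "(z', w') \<in> R" "foot w \<in> V i" "foot w' \<in> V i" for z w z' w' i
  proof -
    have "foot z \<in> U i" "foot z' \<in> U i"
      using U that disjoint_V by metis+
    then show ?thesis using R that unfolding partial_iso_def by metis
  qed
  moreover have "(reflect z, reflect w) \<in> R" if "(z, w) \<in> R" for z w
    using R that unfolding partial_iso_def by blast
  ultimately show ?thesis
    using U unfolding partial_iso_def converse_iff by (intro conjI allI impI) blast+
qed

context
  fixes R
  assumes R: "partial_iso U V R"
begin

lemma reflect_closed: "(z, w) \<in> R \<Longrightarrow> (reflect z, reflect w) \<in> R"
  using R unfolding partial_iso_def by blast

lemma label_ex: "(z, w) \<in> R \<Longrightarrow> \<exists>i. foot z \<in> U i \<and> foot w \<in> V i"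
  using R unfolding partial_iso_def by blast

lemma label: "(z, w) \<in> R \<Longrightarrow> foot z \<in> U i \<Longrightarrow> foot w \<in> V i"
  using label_ex disjoint_U by metis

lemma order: "(z, w) \<in> R \<Longrightarrow> (z', w') \<in> R \<Longrightarrow> foot z \<in> U i \<Longrightarrow> foot z' \<in> U i \<Longrightarrow>
    foot z < foot z' \<longleftrightarrow> foot w < foot w'"
  using R unfolding partial_iso_def by blast

text \<open>Comparing \<open>z\<close> with itself, the order clause excludes a strict inequality
  between the two images in either direction.\<close>

lemma single_valued_on: "(z, w) \<in> R \<Longrightarrow> (z, w') \<in> R \<Longrightarrow> w = w'"
  using order label_ex by (metis foot_eq_iff linorder_less_linear order_less_irrefl)

text \<open>An order isomorphism onto a dense set is continuous: \<open>w\<close> is squeezed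
  between two points of \<open>V i\<close> close to it, and these are pulled back to bounds around
  \<open>z\<close>.\<close>

lemma local_continuity:
  assumes surj: "\<forall>w i. foot w \<in> V i \<longrightarrow> w \<in> Range R" and zw: "(z, w) \<in> R" and "e > 0"
  shows "\<exists>d>0. \<forall>z' w'. (z', w') \<in> R \<longrightarrow> \<bar>foot z' - foot z\<bar> < d \<longrightarrow> \<bar>foot w' - foot w\<bar> < e"
proof -
  obtain i where i: "foot z \<in> U i" "foot w \<in> V i"
    using label_ex[OF zw] by blast
  obtain e' where e': "e' > 0" "ball (foot w) e' \<subseteq> V i"
    using open_V[of i] i(2) unfolding open_contains_ball by blast
  obtain d' where d': "d' > 0" "ball (foot z) d' \<subseteq> U i"
    using open_U[of i] i(1) unfolding open_contains_ball by blast
  \<comment> \<open>The bound \<open>e'\<close> keeps the squeezing points inside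
    \<open>V i\<close>, where \<open>surj\<close> gives them preimages.\<close>
  have "foot w - min e e' < foot w" "foot w < foot w + min e e'"
    using e' \<open>e > 0\<close> by auto
  then obtain w1 w2 where w12: "foot w - min e e' < foot w1" "foot w1 < foot w"
      "foot w < foot w2" "foot w2 < foot w + min e e'"
    using foot_rational_between by metis
  then have V12: "foot w1 \<in> V i" "foot w2 \<in> V i"
    by (auto intro!: subsetD[OF e'(2)] simp: dist_real_def)
  then obtain z1 z2 where z12: "(z1, w1) \<in> R" "(z2, w2) \<in> R"
    using surj by blast
  then have U12: "foot z1 \<in> U i" "foot z2 \<in> U i"
    using label_ex disjoint_V V12 by metis+
  have less: "foot z1 < foot z" "foot z < foot z2"
    using order z12 zw U12 i w12 by blast+
  \<comment> \<open>The bound \<open>d'\<close> keeps \<open>z'\<close> under the label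
    \<open>i\<close>, so that the order clause applies to it.\<close>
  define d where "d = min d' (min (foot z - foot z1) (foot z2 - foot z))"
  have "\<bar>foot w' - foot w\<bar> < e" if "(z', w') \<in> R" "\<bar>foot z' - foot z\<bar> < d" for z' w'
  proof -
    have "foot z' \<in> ball (foot z) d'" and b: "foot z1 < foot z'" "foot z' < foot z2"
      using that(2) by (auto simp: d_def dist_real_def)
    then have "foot z' \<in> U i" using d' by blast
    then have "foot w1 < foot w'" "foot w' < foot w2"
      using order z12 that(1) U12 b by blast+
    then show ?thesis using w12 by auto
  qed
  moreover have "d > 0" using d' less by (simp add: d_def)
  ultimately show ?thesis by blast
qed

context
  assumes fin: "finite R"
begin

text \<open>What the pairs already in \<open>R\<close> demand of the foot \<open>x\<close> of an
  image of \<open>z\<close>. Here \<open>x\<close> is any real number, so that a midpoint that is no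
  foot can be tested as well.\<close>

definition fits :: "'i \<Rightarrow> rat \<times> rat \<Rightarrow> real \<Rightarrow> bool" where
  "fits i z x \<longleftrightarrow> x \<in> V i \<and> (\<forall>z' w'. (z', w') \<in> R \<longrightarrow> foot z' \<in> U i \<longrightarrow>
      (foot z' < foot z \<longrightarrow> foot w' < x) \<and> (foot z < foot z' \<longrightarrow> x < foot w'))"

text \<open>The images of the points of \<open>R\<close> left and right of \<open>z\<close> under
  the label \<open>i\<close> are finite sets in the right order, so a gap lies between them. The
  extra bounds \<open>F\<close> and \<open>G\<close> serve to separate the images of
  \<open>z\<close> and its conjugate when both have the same label.\<close>

lemma gap:
  assumes z: "foot z \<in> U i" and F: "finite F" "F \<subseteq> V i" and G: "finite G" "G \<subseteq> V i"
    and FG: "\<And>f g. f \<in> F \<Longrightarrow> g \<in> G \<Longrightarrow> f < g"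
    and FR: "\<And>f z' w'. f \<in> F \<Longrightarrow> (z', w') \<in> R \<Longrightarrow> foot z' \<in> U i \<Longrightarrow> foot z < foot z' \<Longrightarrow> f < foot w'"
    and GR: "\<And>g z' w'. g \<in> G \<Longrightarrow> (z', w') \<in> R \<Longrightarrow> foot z' \<in> U i \<Longrightarrow> foot z' < foot z \<Longrightarrow> foot w' < g"
  shows "\<exists>l u. l < u \<and>
    (\<forall>x\<in>{l<..<u}. fits i z x \<and> (\<forall>f\<in>F. f < x) \<and> (\<forall>g\<in>G. x < g))"
proof -
  define L where "L = (foot \<circ> snd) ` {p \<in> R. foot (fst p) \<in> U i \<and> foot (fst p) < foot z}"
  define H where "H = (foot \<circ> snd) ` {p \<in> R. foot (fst p) \<in> U i \<and> foot z < foot (fst p)}"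
  have LH: "finite L" "L \<subseteq> V i" "finite H" "H \<subseteq> V i"
    using fin label by (auto simp: L_def H_def)
  have less: "x < y" if "x \<in> F \<union> L" "y \<in> G \<union> H" for x y
    using that FG FR GR order by (fastforce simp: L_def H_def)
  have "V i \<noteq> {}" using z empty_iff by blast
  then obtain l u where lu: "l < u" "{l<..<u} \<subseteq> V i"
    "\<And>x f. x \<in> {l<..<u} \<Longrightarrow> f \<in> F \<union> L \<Longrightarrow> f < x"
    "\<And>x g. x \<in> {l<..<u} \<Longrightarrow> g \<in> G \<union> H \<Longrightarrow> x < g"
    using gap_in_open_set[OF open_V[of i], of "F \<union> L" "G \<union> H"] LH F G less by (metis Un_least finite_Un)
  have "fits i z x" if "x \<in> {l<..<u}" for x
    unfolding fits_def
  proof (intro conjI allI impI)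
    show "x \<in> V i" using lu that by blast
    fix z' w' assume *: "(z', w') \<in> R" "foot z' \<in> U i"
    { assume "foot z' < foot z"
      then have "foot w' \<in> L" using * by (force simp: L_def)
      then show "foot w' < x" using lu that by blast }
    { assume "foot z < foot z'"
      then have "foot w' \<in> H" using * by (force simp: H_def)
      then show "x < foot w'" using lu that by blast }
  qed
  then show ?thesis using lu by blast
qed

text \<open>Comparisons with \<open>R\<close> are covered by \<open>fits\<close>; the only other one
  is between \<open>z\<close> and its conjugate, and it counts only when they share a label.\<close>

lemma partial_iso_insert:
  assumes z: "foot z \<in> U i" "foot (reflect z) \<in> U j" "z \<notin> Domain R"
    and w: "fits i z (foot w)" "fits j (reflect z) (foot (reflect w))"
    and zw: "i = j \<Longrightarrow> foot z < foot (reflect z) \<longleftrightarrow> foot w < foot (reflect w)"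
      "i = j \<Longrightarrow> foot (reflect z) < foot z \<longleftrightarrow> foot (reflect w) < foot w"
  shows "partial_iso U V (insert (z, w) (insert (reflect z, reflect w) R))"
proof -
  have cz: "reflect z \<notin> Domain R"
    using z(3) reflect_closed by (metis Domain.simps reflect_reflect)
  \<comment> \<open>As \<open>y\<close> is outside the domain, every \<open>z'\<close> lies strictly
    on one side of it, which turns the implications of \<open>fits\<close> into
    equivalences.\<close>
  have ord1: "(foot z' < foot y \<longleftrightarrow> foot w' < x) \<and> (foot y < foot z' \<longleftrightarrow> x < foot w')"
    if "(z', w') \<in> R" "foot z' \<in> U k" "fits k y x" "y \<notin> Domain R" for z' w' x y k
  proof -
    have "z' \<noteq> y" using that by auto
    then have "foot z' < foot y \<or> foot y < foot z'"
      by (metis foot_eq_iff linorder_less_linear)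
    then show ?thesis using that unfolding fits_def by (meson order_less_asym)
  qed
  let ?R = "insert (z, w) (insert (reflect z, reflect w) R)"
  have "foot x < foot x' \<longleftrightarrow> foot y < foot y'"
    if "(x, y) \<in> ?R" "(x', y') \<in> ?R" "foot x \<in> U k" "foot x' \<in> U k" for x y x' y' k
  proof -
    have i: "k = i" if "foot z \<in> U k" using that z disjoint_U by blast
    have j: "k = j" if "foot (reflect z) \<in> U k" using that z disjoint_U by blast
    have new: "fits k t (foot s) \<and> t \<notin> Domain R" if "(t, s) \<notin> R" "(t, s) \<in> ?R" "foot t \<in> U k" for t s
      using that w i j z(3) cz by auto
    show ?thesis
    proof (cases "(x, y) \<in> R"; cases "(x', y') \<in> R")
      assume "(x, y) \<in> R" "(x', y') \<in> R"
      then show ?thesis using order that(3,4) by blast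
    next
      assume "(x, y) \<in> R" "(x', y') \<notin> R"
      then show ?thesis using ord1[of x y k x' "foot y'"] new[of x' y'] that by blast
    next
      assume "(x, y) \<notin> R" "(x', y') \<in> R"
      then show ?thesis using ord1[of x' y' k x "foot y"] new[of x y] that by blast
    next
      assume "(x, y) \<notin> R" "(x', y') \<notin> R"
      then have "x = z \<and> y = w \<or> x = reflect z \<and> y = reflect w"
        "x' = z \<and> y' = w \<or> x' = reflect z \<and> y' = reflect w"
        using that by auto
      then show ?thesis
        using that(3,4) i j zw by (elim disjE conjE) simp_all
    qed
  qed
  moreover have "\<exists>i. foot x \<in> U i \<and> foot y \<in> V i" if "(x, y) \<in> ?R" for x y
  proof (cases "(x, y) \<in> R")
    case False
    then have "x = z \<and> y = w \<or> x = reflect z \<and> y = reflect w" using that by auto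
    then show ?thesis using z w unfolding fits_def by blast
  qed (rule label_ex)
  moreover have "(reflect x, reflect y) \<in> ?R" if "(x, y) \<in> ?R" for x y
    using that reflect_closed[of x y] by auto
  ultimately show ?thesis unfolding partial_iso_def by meson
qed

text \<open>\<open>z\<close> and its conjugate have to be added together. A gap is found for each
  image, and the density of conjugate pairs provides one \<open>w\<close> that meets both.\<close>

lemma partial_iso_extend:
  assumes z: "foot z \<in> U i" "foot (reflect z) \<in> U j"
  shows "\<exists>R'. finite R' \<and> partial_iso U V R' \<and> R \<subseteq> R' \<and> z \<in> Domain R'"
proof (cases "z \<in> Domain R")
  case True
  then show ?thesis using R fin by blast
next
  case new: False
  obtain l u where lu: "l < u" "\<And>x. x \<in> {l<..<u} \<Longrightarrow> fits i z x"
    using gap[OF z(1), of "{}" "{}"] by blast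
  have "\<exists>w. fits i z (foot w) \<and> fits j (reflect z) (foot (reflect w)) \<and>
    (i = j \<longrightarrow> (foot z < foot (reflect z) \<longleftrightarrow> foot w < foot (reflect w)) \<and>
     (foot (reflect z) < foot z \<longleftrightarrow> foot (reflect w) < foot w))"
  proof (cases "reflect z = z")
    case True
    then have "i = j" using z disjoint_U by metis
    \<comment> \<open>A point fixed by conjugation needs an image fixed by conjugation, so a
      rational point of the gap is taken.\<close>
    moreover obtain w where "reflect w = w" "l < foot w" "foot w < u"
      using foot_rational_between lu(1) by blast
    ultimately show ?thesis using lu True by (intro exI[of _ w]) auto
  next
    case False
    then consider "i \<noteq> j" | "i = j" "foot z < foot (reflect z)" | "i = j" "foot (reflect z) < foot z"
      by (metis foot_eq_iff linorder_less_linear)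
    then show ?thesis
    proof cases
      case 1
      obtain l' u' where lu': "l' < u'" "\<And>x. x \<in> {l'<..<u'} \<Longrightarrow> fits j (reflect z) x"
        using gap[OF z(2), of "{}" "{}"] by blast
      \<comment> \<open>Under distinct labels the two feet are placed independently.\<close>
      obtain w where "l < foot w" "foot w < u" "l' < foot (reflect w)" "foot (reflect w) < u'"
        using foot_pair_between lu(1) lu'(1) by blast
      then show ?thesis using 1 lu lu' by (intro exI[of _ w]) auto
    next
      case 2
      \<comment> \<open>Both images lie in the same \<open>V i\<close> and must keep their order.
        The cut \<open>m\<close> separates them: \<open>w\<close> goes below it, and a gap for the
        conjugate is sought above it.\<close>
      define m where "m = (l + u) / 2"
      have m: "l < m" "m < u" "fits i z m" using lu by (auto simp: m_def)
      \<comment> \<open>Points of \<open>R\<close> beyond \<open>reflect z\<close> are also beyond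
        \<open>z\<close>, where \<open>m\<close> fits; hence \<open>m\<close> is admissible as an
        extra lower bound in \<open>gap\<close>.\<close>
      have "m < foot w'" if "(z', w') \<in> R" "foot z' \<in> U j" "foot (reflect z) < foot z'" for z' w'
        using that m(3) 2 unfolding fits_def by (meson order_less_trans)
      moreover have "m \<in> V j" using m(3) 2 unfolding fits_def by blast
      ultimately have "\<exists>l' u'. l' < u' \<and> (\<forall>x\<in>{l'<..<u'}. fits j (reflect z) x \<and>
          (\<forall>f\<in>{m}. f < x) \<and> (\<forall>g\<in>{}. x < g))"
        by (intro gap[OF z(2)]) auto
      then obtain l' u' where lu': "l' < u'" "\<And>x. x \<in> {l'<..<u'} \<Longrightarrow> fits j (reflect z) x"
          "\<And>x. x \<in> {l'<..<u'} \<Longrightarrow> m < x"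
        by blast
      obtain w where w: "l < foot w" "foot w < m" "l' < foot (reflect w)" "foot (reflect w) < u'"
        using foot_pair_between m(1) lu'(1) by blast
      moreover have "foot w < foot (reflect w)" using lu'(3)[of "foot (reflect w)"] w by simp
      ultimately show ?thesis using 2 lu lu' m by (intro exI[of _ w]) auto
    next
      case 3
      define m where "m = (l + u) / 2"
      have m: "l < m" "m < u" "fits i z m" using lu by (auto simp: m_def)
      have "foot w' < m" if "(z', w') \<in> R" "foot z' \<in> U j" "foot z' < foot (reflect z)" for z' w'
        using that m(3) 3 unfolding fits_def by (meson order_less_trans)
      moreover have "m \<in> V j" using m(3) 3 unfolding fits_def by blast
      ultimately have "\<exists>l' u'. l' < u' \<and> (\<forall>x\<in>{l'<..<u'}. fits j (reflect z) x \<and>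
          (\<forall>f\<in>{}. f < x) \<and> (\<forall>g\<in>{m}. x < g))"
        by (intro gap[OF z(2)]) auto
      then obtain l' u' where lu': "l' < u'" "\<And>x. x \<in> {l'<..<u'} \<Longrightarrow> fits j (reflect z) x"
          "\<And>x. x \<in> {l'<..<u'} \<Longrightarrow> x < m"
        by blast
      obtain w where w: "m < foot w" "foot w < u" "l' < foot (reflect w)" "foot (reflect w) < u'"
        using foot_pair_between m(2) lu'(1) by blast
      moreover have "foot (reflect w) < foot w" using lu'(3)[of "foot (reflect w)"] w by simp
      ultimately show ?thesis using 3 lu lu' m by (intro exI[of _ w]) auto
    qed
  qed
  then obtain w where "partial_iso U V (insert (z, w) (insert (reflect z, reflect w) R))"
    using partial_iso_insert[OF z new] by blast
  then show ?thesis
    using fin by (intro exI[of _ "insert (z, w) (insert (reflect z, reflect w) R)"]) auto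
qed

end

end

end

section \<open>The back-and-forth construction\<close>

text \<open>Stage n puts the n-th element of each countable type into the domain or the range,
  provided that it belongs to \<open>S\<close> or \<open>T\<close>.\<close>

lemma back_and_forth:
  fixes P :: "('a::countable \<times> 'b::countable) set \<Rightarrow> bool"
  assumes empty: "P {}"
    and forward: "\<And>R x. finite R \<Longrightarrow> P R \<Longrightarrow> x \<in> S \<Longrightarrow>
      \<exists>R'. finite R' \<and> P R' \<and> R \<subseteq> R' \<and> x \<in> Domain R'"
    and backward: "\<And>R y. finite R \<Longrightarrow> P R \<Longrightarrow> y \<in> T \<Longrightarrow>
      \<exists>R'. finite R' \<and> P R' \<and> R \<subseteq> R' \<and> y \<in> Range R'"
  shows "\<exists>C. incseq C \<and> (\<forall>n. P (C n)) \<and> S \<subseteq> Domain (\<Union>n. C n) \<and> T \<subseteq> Range (\<Union>n. C n)"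
proof -
  define Q where "Q n R R' \<longleftrightarrow> R \<subseteq> R' \<and> (from_nat n \<in> S \<longrightarrow> from_nat n \<in> Domain R') \<and>
    (from_nat n \<in> T \<longrightarrow> from_nat n \<in> Range R')" for n and R R' :: "('a \<times> 'b) set"
  have step: "\<exists>R'. (finite R' \<and> P R') \<and> Q n R R'" if "finite R \<and> P R" for R n
  proof -
    have "\<exists>R'. finite R' \<and> P R' \<and> R \<subseteq> R' \<and> (from_nat n \<in> S \<longrightarrow> from_nat n \<in> Domain R')"
    proof (cases "from_nat n \<in> S")
      case True
      then show ?thesis using forward[of R "from_nat n"] that by simp
    next
      case False
      then show ?thesis using that by (intro exI[of _ R]) simp
    qed
    then obtain R1 where R1: "finite R1" "P R1" "R \<subseteq> R1"
        "from_nat n \<in> S \<longrightarrow> from_nat n \<in> Domain R1"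
      by (elim exE conjE)
    have "\<exists>R'. finite R' \<and> P R' \<and> R1 \<subseteq> R' \<and> (from_nat n \<in> T \<longrightarrow> from_nat n \<in> Range R')"
    proof (cases "from_nat n \<in> T")
      case True
      then show ?thesis using backward[of R1 "from_nat n"] R1 by simp
    next
      case False
      then show ?thesis using R1 by (intro exI[of _ R1]) simp
    qed
    then obtain R2 where R2: "finite R2" "P R2" "R1 \<subseteq> R2"
        "from_nat n \<in> T \<longrightarrow> from_nat n \<in> Range R2"
      by (elim exE conjE)
    have "from_nat n \<in> S \<longrightarrow> from_nat n \<in> Domain R2"
      using R1(4) Domain_mono[OF R2(3)] by (meson subsetD)
    then show ?thesis
      using R1(3) R2 unfolding Q_def by (intro exI[of _ R2]) simp
  qed
  have "\<exists>C. \<forall>n. (finite (C n) \<and> P (C n)) \<and> Q n (C n) (C (Suc n))"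
  proof (rule dependent_nat_choice)
    show "\<exists>R. finite R \<and> P R" using empty by (intro exI[of _ "{}"]) simp
  qed (rule step)
  then obtain C where "\<forall>n. (finite (C n) \<and> P (C n)) \<and> Q n (C n) (C (Suc n))" ..
  then have C: "\<And>n. finite (C n) \<and> P (C n)" "\<And>n. Q n (C n) (C (Suc n))"
    by simp_all
  show ?thesis
  proof (intro exI conjI allI)
    show "incseq C" using C(2) unfolding Q_def by (intro incseq_SucI) blast
    show "P (C n)" for n using C(1) by simp
    show "S \<subseteq> Domain (\<Union>n. C n)"
    proof
      fix x assume "x \<in> S"
      then have "x \<in> Domain (C (Suc (to_nat x)))"
        using C(2)[of "to_nat x"] by (simp add: Q_def)
      then show "x \<in> Domain (\<Union>n. C n)" by blast
    qed
    show "T \<subseteq> Range (\<Union>n. C n)"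
    proof
      fix y assume "y \<in> T"
      then have "y \<in> Range (C (Suc (to_nat y)))"
        using C(2)[of "to_nat y"] by (simp add: Q_def)
      then show "y \<in> Range (\<Union>n. C n)" by blast
    qed
  qed
qed

text \<open>Each clause involves at most two pairs, and these lie in a common stage of the
  chain.\<close>

lemma partial_iso_UN:
  assumes "incseq C" and C: "\<And>n. partial_iso U V (C n)"
  shows "partial_iso U V (\<Union>n. C n)"
proof -
  have common: "\<exists>k. p \<in> C k \<and> q \<in> C k" if "p \<in> C m" "q \<in> C n" for p q m n
    using that incseqD[OF \<open>incseq C\<close>, of m "max m n"] incseqD[OF \<open>incseq C\<close>, of n "max m n"]
    by (intro exI[of _ "max m n"]) auto
  show ?thesis
    unfolding partial_iso_def
  proof (intro conjI allI impI)
    fix z w assume "(z, w) \<in> (\<Union>n. C n)"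
    then obtain n where n: "(z, w) \<in> C n" by blast
    then show "(reflect z, reflect w) \<in> (\<Union>n. C n)" "\<exists>i. foot z \<in> U i \<and> foot w \<in> V i"
      using C[of n] unfolding partial_iso_def by blast+
  next
    fix z w z' w' i
    assume *: "(z, w) \<in> (\<Union>n. C n)" "(z', w') \<in> (\<Union>n. C n)" "foot z \<in> U i" "foot z' \<in> U i"
    then obtain k where "(z, w) \<in> C k" "(z', w') \<in> C k" using common by blast
    then show "(foot z < foot z') = (foot w < foot w')"
      using C[of k] * unfolding partial_iso_def by blast
  qed
qed

lemma (in label_pair) total_partial_iso:
  assumes U: "\<And>z i. foot z \<in> U i \<Longrightarrow> \<exists>j. foot (reflect z) \<in> U j"
    and V: "\<And>z i. foot z \<in> V i \<Longrightarrow> \<exists>j. foot (reflect z) \<in> V j"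
  obtains R where "partial_iso U V R" "\<And>z i. foot z \<in> U i \<Longrightarrow> z \<in> Domain R"
    "\<And>w i. foot w \<in> V i \<Longrightarrow> w \<in> Range R"
proof -
  define S where "S W = {z. \<exists>i. foot z \<in> W i}" for W :: "'i \<Rightarrow> real set"
  \<comment> \<open>The backward half is the forward half for the exchanged families, applied to the
    converse relation.\<close>
  interpret sw: label_pair V U by (rule swap)
  have "\<exists>C. incseq C \<and> (\<forall>n. partial_iso U V (C n)) \<and>
    S U \<subseteq> Domain (\<Union>n. C n) \<and> S V \<subseteq> Range (\<Union>n. C n)"
  proof (rule back_and_forth)
    show "partial_iso U V {}" by (simp add: partial_iso_def)
    show "\<exists>R'. finite R' \<and> partial_iso U V R' \<and> R \<subseteq> R' \<and> x \<in> Domain R'"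
      if R: "finite R" "partial_iso U V R" and x: "x \<in> S U" for R x
    proof -
      obtain i j where "foot x \<in> U i" "foot (reflect x) \<in> U j"
        using x U unfolding S_def by blast
      then show ?thesis using partial_iso_extend[OF R(2,1)] by blast
    qed
    show "\<exists>R'. finite R' \<and> partial_iso U V R' \<and> R \<subseteq> R' \<and> y \<in> Range R'"
      if R: "finite R" "partial_iso U V R" and y: "y \<in> S V" for R y
    proof -
      obtain i j where ij: "foot y \<in> V i" "foot (reflect y) \<in> V j"
        using y V unfolding S_def by blast
      have "finite (R\<inverse>)" using R(1) by simp
      then obtain R' where R': "finite R'" "partial_iso V U R'" "R\<inverse> \<subseteq> R'" "y \<in> Domain R'"
        using sw.partial_iso_extend[OF partial_iso_converse[OF R(2)] _ ij] by blast
      have "R \<subseteq> R'\<inverse>" using R'(3) by auto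
      moreover have "y \<in> Range (R'\<inverse>)" using R'(4) by simp
      ultimately show ?thesis
        using sw.partial_iso_converse[OF R'(2)] R'(1) by (meson finite_converse)
    qed
  qed
  then obtain C where C: "incseq C" "\<And>n. partial_iso U V (C n)"
    "S U \<subseteq> Domain (\<Union>n. C n)" "S V \<subseteq> Range (\<Union>n. C n)"
    by blast
  show thesis
  proof (rule that)
    show "partial_iso U V (\<Union>n. C n)" by (rule partial_iso_UN[OF C(1,2)])
    show "z \<in> Domain (\<Union>n. C n)" if "foot z \<in> U i" for z i
      using C(3) that unfolding S_def by blast
    show "w \<in> Range (\<Union>n. C n)" if "foot w \<in> V i" for w i
      using C(4) that unfolding S_def by blast
  qed
qed

section \<open>The topology and continuity in terms of feet\<close>

definition near :: "real \<Rightarrow> rat \<times> rat \<Rightarrow> real \<Rightarrow> bool" where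
  "near e p x \<longleftrightarrow> \<bar>x - foot p\<bar> < e \<or> \<bar>x - foot (reflect p)\<bar> < e"

lemma near_upper [simp]: "near e (upper p) x = near e p x"
  using upper_cases[of p] by (auto simp: near_def)

lemma upper_rational: "reflect q = q \<Longrightarrow> upper q = q"
  using upper_cases[of q] by auto

lemma openin_bing_space_near:
  "openin bing_space W \<longleftrightarrow> W \<subseteq> bing_set \<and>
    (\<forall>p\<in>W. \<exists>e>0. \<forall>q. reflect q = q \<longrightarrow> near e p (foot q) \<longrightarrow> q \<in> W)"
proof -
  have "bing_base_interval (real_of_rat a - real_of_rat b / sqrt 3) e \<union>
      bing_base_interval (real_of_rat a + real_of_rat b / sqrt 3) e
    = {q. reflect q = q \<and> near e (a, b) (foot q)}" for a b e
    by (auto simp: bing_base_interval_def bing_set_def near_def foot_def reflect_def of_rat_minus)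
  then show ?thesis
    unfolding openin_bing_space bing_open_def by (simp add: subset_iff Ball_def imp_conjL)
qed

text \<open>Only axis points near \<open>x\<close> test openness at \<open>x\<close>. Exempting
  \<open>q = x\<close> matters: \<open>h\<close> may move an axis point off the axis, and
  \<open>h x \<in> W\<close> is known there anyway.\<close>

lemma continuous_map_bing_spaceI:
  assumes h: "\<And>x. x \<in> bing_set \<Longrightarrow> h x \<in> bing_set"
    and near: "\<And>x e. x \<in> bing_set \<Longrightarrow> e > 0 \<Longrightarrow> \<exists>d>0. \<forall>q. reflect q = q \<longrightarrow> q \<noteq> x \<longrightarrow>
      near d x (foot q) \<longrightarrow> reflect (h q) = h q \<and> near e (h x) (foot (h q))"
  shows "continuous_map bing_space bing_space h"
  unfolding continuous_map_def topspace_bing_space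
proof (intro conjI allI impI)
  show "h \<in> bing_set \<rightarrow> bing_set" using h by blast
  fix W assume W: "openin bing_space W"
  show "openin bing_space {x \<in> bing_set. h x \<in> W}"
    unfolding openin_bing_space_near
  proof (intro conjI ballI)
    fix x assume x: "x \<in> {x \<in> bing_set. h x \<in> W}"
    then obtain e where e: "e > 0" "\<And>q. reflect q = q \<Longrightarrow> near e (h x) (foot q) \<Longrightarrow> q \<in> W"
      using W unfolding openin_bing_space_near by blast
    obtain d where d: "d > 0" "\<And>q. reflect q = q \<Longrightarrow> q \<noteq> x \<Longrightarrow>
      near d x (foot q) \<Longrightarrow> reflect (h q) = h q \<and> near e (h x) (foot (h q))"
      using near[of x e] x e by blast
    have "q \<in> {x \<in> bing_set. h x \<in> W}" if q: "reflect q = q" "near d x (foot q)" for q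
    proof (cases "q = x")
      case False
      moreover have "q \<in> bing_set" using upper_rational[OF q(1)] upper_in_bing_set by metis
      ultimately show ?thesis using d(2)[OF q(1) _ q(2)] e by blast
    qed (use x in simp)
    then show "\<exists>d>0. \<forall>q. reflect q = q \<longrightarrow> near d x (foot q) \<longrightarrow> q \<in> {x \<in> bing_set. h x \<in> W}"
      using d(1) by blast
  qed simp
qed

section \<open>Covers of the complement of a finite set and the induced homeomorphism\<close>

text \<open>The second condition makes the labels with empty sets depend on \<open>I\<close> only, so that the covers
  for two families over \<open>I\<close> can be matched.\<close>

definition star_cover ::
  "'i set \<Rightarrow> ('i \<Rightarrow> rat \<times> rat) \<Rightarrow> ('i \<times> nat \<Rightarrow> real set) \<Rightarrow> bool" where
  "star_cover I a U \<longleftrightarrow>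
     (\<forall>l. open (U l)) \<and>
     (\<forall>l. U l = {} \<longleftrightarrow> fst l \<notin> I) \<and>
     (\<forall>l l' x. x \<in> U l \<longrightarrow> x \<in> U l' \<longrightarrow> l = l') \<and>
     (\<forall>z. (\<exists>l. foot z \<in> U l) \<longleftrightarrow> upper z \<notin> a ` I) \<and>
     (\<forall>i\<in>I. \<forall>N. \<exists>d>0. \<forall>z. upper z \<noteq> a i \<longrightarrow> near d (a i) (foot z) \<longrightarrow>
        (\<exists>m\<ge>N. foot z \<in> U (i, m))) \<and>
     (\<forall>i\<in>I. \<forall>e>0. \<exists>N. \<forall>m\<ge>N. \<forall>x\<in>U (i, m). near e (a i) x)"

lemma star_cover_label_pair:
  assumes "star_cover I a U" "star_cover I b V"
  shows "label_pair U V"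
  using assms unfolding star_cover_def by unfold_locales metis+

lemma star_cover_foot_iff:
  "star_cover I a U \<Longrightarrow> (\<exists>l. foot z \<in> U l) \<longleftrightarrow> upper z \<notin> a ` I"
  unfolding star_cover_def by blast

text \<open>Near a removed point \<open>a i\<close>, axis points have labels \<open>(i, m)\<close>
  with large m; \<open>R\<close> keeps the label, and \<open>V (i, m)\<close> is close to
  \<open>b i\<close>. Elsewhere \<open>local_continuity\<close> is applied at both feet.\<close>

lemma continuous_map_star:
  assumes U: "star_cover I a U" and V: "star_cover I b V" and R: "partial_iso U V R"
    and dom: "\<And>z l. foot z \<in> U l \<Longrightarrow> z \<in> Domain R"
    and ran: "\<And>w l. foot w \<in> V l \<Longrightarrow> w \<in> Range R"
    and b: "b ` I \<subseteq> bing_set"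
    and ha: "\<And>i. i \<in> I \<Longrightarrow> h (a i) = b i"
    and hR: "\<And>z w. (z, w) \<in> R \<Longrightarrow> h (upper z) = upper w"
  shows "continuous_map bing_space bing_space h"
proof (rule continuous_map_bing_spaceI)
  interpret label_pair U V using U V by (rule star_cover_label_pair)
  note cov = star_cover_foot_iff[OF U]
  \<comment> \<open>Axis points go to axis points: \<open>q\<close> is related to both
    \<open>w\<close> and \<open>reflect w\<close>, which must agree.\<close>
  have img: "reflect w = w \<and> h q = w" if "(q, w) \<in> R" "reflect q = q" for q w
  proof -
    have "reflect w = w"
      using single_valued_on[OF R that(1)] reflect_closed[OF R that(1)] that(2) by metis
    then show ?thesis
      using hR[OF that(1)] upper_rational that(2) by metis
  qed
  have ran': "\<forall>w i. foot w \<in> V i \<longrightarrow> w \<in> Range R" using ran by blast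
  fix x assume x: "x \<in> bing_set"
  then have ux: "upper x = x" by (rule upper_bing_set)
  { assume "x \<notin> a ` I"
    then have "\<exists>w. (x, w) \<in> R" using cov[of x] ux dom by (metis DomainE) }
  note out = this
  show "h x \<in> bing_set"
  proof (cases "x \<in> a ` I")
    case True
    then show ?thesis using ha b by auto
  next
    case False
    then show ?thesis using out hR ux by (metis upper_in_bing_set)
  qed
  fix e :: real assume e: "e > 0"
  show "\<exists>d>0. \<forall>q. reflect q = q \<longrightarrow> q \<noteq> x \<longrightarrow>
      near d x (foot q) \<longrightarrow> reflect (h q) = h q \<and> near e (h x) (foot (h q))"
  proof (cases "x \<in> a ` I")
    case True
    then obtain i where i: "i \<in> I" "x = a i" by blast
    obtain N where N: "\<And>m y. m \<ge> N \<Longrightarrow> y \<in> V (i, m) \<Longrightarrow> near e (b i) y"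
      using V i e unfolding star_cover_def by meson
    obtain d where d: "d > 0" "\<And>z. upper z \<noteq> a i \<Longrightarrow> near d (a i) (foot z) \<Longrightarrow>
        \<exists>m\<ge>N. foot z \<in> U (i, m)"
      using U i unfolding star_cover_def by meson
    have "reflect (h q) = h q \<and> near e (h x) (foot (h q))"
      if q: "reflect q = q" "q \<noteq> x" "near d x (foot q)" for q
    proof -
      obtain m where m: "m \<ge> N" "foot q \<in> U (i, m)"
        using d(2)[of q] q i upper_rational by metis
      then obtain w where w: "(q, w) \<in> R" using dom by blast
      then have "foot w \<in> V (i, m)" using label[OF R] m by blast
      then show ?thesis using img[OF w q(1)] N m i ha by auto
    qed
    then show ?thesis using d(1) by blast
  next
    case False
    then obtain w where w: "(x, w) \<in> R" using out by blast
    obtain d1 where d1: "d1 > 0" "\<And>z' w'. (z', w') \<in> R \<Longrightarrow> \<bar>foot z' - foot x\<bar> < d1 \<Longrightarrow>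
        \<bar>foot w' - foot w\<bar> < e"
      using local_continuity[OF R ran' w e] by blast
    obtain d2 where d2: "d2 > 0" "\<And>z' w'. (z', w') \<in> R \<Longrightarrow> \<bar>foot z' - foot (reflect x)\<bar> < d2 \<Longrightarrow>
        \<bar>foot w' - foot (reflect w)\<bar> < e"
      using local_continuity[OF R ran' reflect_closed[OF R w] e] by blast
    obtain l l' where l: "foot x \<in> U l" "foot (reflect x) \<in> U l'"
      using label_ex[OF R] w reflect_closed[OF R w] by metis
    obtain d3 where d3: "d3 > 0" "ball (foot x) d3 \<subseteq> U l"
      using open_U l(1) unfolding open_contains_ball by blast
    obtain d4 where d4: "d4 > 0" "ball (foot (reflect x)) d4 \<subseteq> U l'"
      using open_U l(2) unfolding open_contains_ball by blast
    \<comment> \<open>\<open>d3\<close> and \<open>d4\<close> put \<open>q\<close> into the domain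
      of \<open>R\<close>; \<open>d1\<close> and \<open>d2\<close> then control its image.\<close>
    define d where "d = min (min d1 d2) (min d3 d4)"
    have "reflect (h q) = h q \<and> near e (h x) (foot (h q))"
      if q: "reflect q = q" "near d x (foot q)" for q
    proof -
      have "foot q \<in> ball (foot x) d3 \<or> foot q \<in> ball (foot (reflect x)) d4"
        using q(2) by (auto simp: near_def d_def dist_real_def)
      then obtain v where v: "(q, v) \<in> R" using d3(2) d4(2) dom by blast
      have "near e w (foot v)"
        using q(2) d1(2)[OF v] d2(2)[OF v] by (auto simp: near_def d_def)
      then show ?thesis using img[OF v q(1)] hR[OF w] ux by simp
    qed
    moreover have "d > 0" using d1(1) d2(1) d3(1) d4(1) by (simp add: d_def)
    ultimately show ?thesis by blast
  qed
qed

text \<open>\<open>R\<close> commutes with conjugation and is single-valued, so it descends to the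
  quotient by conjugation, whichever representative is chosen.\<close>

lemma star_map_exists:
  assumes U: "star_cover I a U" and V: "star_cover I b V" and R: "partial_iso U V R"
    and a: "inj_on a I"
  obtains h where "\<And>i. i \<in> I \<Longrightarrow> h (a i) = b i" "\<And>z w. (z, w) \<in> R \<Longrightarrow> h (upper z) = upper w"
proof -
  interpret label_pair U V using U V by (rule star_cover_label_pair)
  define h where "h x = (if x \<in> a ` I then b (inv_into I a x) else upper (SOME w. (x, w) \<in> R))" for x
  show thesis
  proof (rule that[of h])
    show "h (a i) = b i" if "i \<in> I" for i
      using that a by (simp add: h_def)
    show "h (upper z) = upper w" if zw: "(z, w) \<in> R" for z w
    proof -
      have "\<exists>l. foot z \<in> U l" using label_ex[OF R zw] by blast
      then have "upper z \<notin> a ` I" using star_cover_foot_iff[OF U] by blast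
      moreover obtain w' where w': "(upper z, w') \<in> R" "upper w' = upper w"
        using upper_cases[of z] zw reflect_closed[OF R zw] by (metis upper_reflect)
      then have "(SOME w. (upper z, w) \<in> R) = w'"
        using single_valued_on[OF R] by blast
      ultimately show ?thesis using w' by (simp add: h_def)
    qed
  qed
qed

text \<open>The relation and its converse induce mutually inverse maps, and continuity of both
  follows from the same result with the covers exchanged.\<close>

lemma homeomorphic_map_star:
  assumes U: "star_cover I a U" and V: "star_cover I b V"
    and a: "inj_on a I" "a ` I \<subseteq> bing_set" and b: "inj_on b I" "b ` I \<subseteq> bing_set"
  shows "\<exists>h. homeomorphic_map bing_space bing_space h \<and> (\<forall>i\<in>I. h (a i) = b i)"
proof -
  interpret label_pair U V using U V by (rule star_cover_label_pair)
  note covU = star_cover_foot_iff[OF U] and covV = star_cover_foot_iff[OF V]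
  have "\<exists>l. foot (reflect z) \<in> U l" if "foot z \<in> U l'" for z l'
    using that covU[of z] covU[of "reflect z"] unfolding upper_reflect by blast
  moreover have "\<exists>l. foot (reflect z) \<in> V l" if "foot z \<in> V l'" for z l'
    using that covV[of z] covV[of "reflect z"] unfolding upper_reflect by blast
  ultimately obtain R where R: "partial_iso U V R"
    and dom: "\<And>z l. foot z \<in> U l \<Longrightarrow> z \<in> Domain R"
    and ran: "\<And>w l. foot w \<in> V l \<Longrightarrow> w \<in> Range R"
    by (rule total_partial_iso) blast+
  have R': "partial_iso V U (R\<inverse>)" by (rule partial_iso_converse[OF R])
  obtain h where h: "\<And>i. i \<in> I \<Longrightarrow> h (a i) = b i" "\<And>z w. (z, w) \<in> R \<Longrightarrow> h (upper z) = upper w"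
    by (rule star_map_exists[OF U V R a(1)]) blast
  obtain k where k: "\<And>i. i \<in> I \<Longrightarrow> k (b i) = a i" "\<And>w z. (w, z) \<in> R\<inverse> \<Longrightarrow> k (upper w) = upper z"
    by (rule star_map_exists[OF V U R' b(1)]) blast
  have "continuous_map bing_space bing_space h"
    by (rule continuous_map_star[OF U V R dom ran b(2) h])
  moreover have "continuous_map bing_space bing_space k"
    by (rule continuous_map_star[OF V U R' _ _ a(2) k]) (use dom ran in auto)
  moreover have "k (h x) = x" if x: "x \<in> bing_set" for x
  proof (cases "x \<in> a ` I")
    case False
    then have "x \<in> Domain R" using covU[of x] upper_bing_set[OF x] dom by metis
    then obtain w where "(x, w) \<in> R" by blast
    then show ?thesis using h(2)[of x w] k(2)[of w x] upper_bing_set[OF x] by simp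
  qed (use h k in auto)
  moreover have "h (k x) = x" if x: "x \<in> bing_set" for x
  proof (cases "x \<in> b ` I")
    case False
    then have "x \<in> Range R" using covV[of x] upper_bing_set[OF x] ran by metis
    then obtain z where "(z, x) \<in> R" by blast
    then show ?thesis using h(2)[of z x] k(2)[of x z] upper_bing_set[OF x] by simp
  qed (use h k in auto)
  ultimately have "homeomorphic_maps bing_space bing_space h k"
    by (simp add: homeomorphic_maps_def topspace_bing_space)
  then show ?thesis using h(1) homeomorphic_map_maps by blast
qed

section \<open>Construction of the cover from annuli\<close>

text \<open>\<open>U (i, m)\<close> collects the m-th annuli around the feet of \<open>a i\<close>,
  all of outer radius at most \<open>s\<close>; these shrink to the feet. What lies farther than
  \<open>s\<close> from every foot is added to a single label.\<close>

lemma star_cover_exists: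
  assumes "finite I" "I \<noteq> {}" "inj_on a I" "a ` I \<subseteq> bing_set"
  obtains U where "star_cover I a U"
proof -
  define \<Phi> where "\<Phi> i = {foot (a i), foot (reflect (a i))}" for i
  define F where "F = (\<Union>i\<in>I. \<Phi> i)"
  have F: "finite F" using \<open>finite I\<close> by (simp add: F_def \<Phi>_def)
  have \<Phi>_iff: "foot z \<in> \<Phi> i \<longleftrightarrow> upper z = a i" if "i \<in> I" for z i
  proof -
    have "upper (a i) = a i" using that assms(4) upper_bing_set by blast
    then show ?thesis using upper_eq_iff[of z "a i"] by (auto simp: \<Phi>_def)
  qed
  have F_iff: "foot z \<in> F \<longleftrightarrow> upper z \<in> a ` I" for z
    using \<Phi>_iff by (auto simp: F_def)
  have F_foot: "\<exists>z. p = foot z" if "p \<in> F" for p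
    using that by (auto simp: F_def \<Phi>_def)
  have \<Phi>_disjoint: "i = j" if ij: "i \<in> I" "j \<in> I" "p \<in> \<Phi> i" "p \<in> \<Phi> j" for i j p
  proof -
    obtain z where "p = foot z" using F_foot[of p] ij unfolding F_def by blast
    then show ?thesis using \<Phi>_iff ij \<open>inj_on a I\<close> by (metis inj_onD)
  qed
  \<comment> \<open>Half the least distance between distinct feet, capped by 1 so that the minimum
    exists even for a single foot.\<close>
  define r where "r = Min (insert 1 ((\<lambda>(p, q). \<bar>p - q\<bar> / 2) ` {(p, q) \<in> F \<times> F. p \<noteq> q}))"
  have fin: "finite ((\<lambda>(p, q). \<bar>p - q\<bar> / 2) ` {(p, q) \<in> F \<times> F. p \<noteq> q})"
    using F by (intro finite_imageI finite_subset[OF _ finite_cartesian_product[OF F F]]) auto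
  have r: "r > 0" using fin by (auto simp: r_def)
  have far: "2 * r \<le> \<bar>p - q\<bar>" if "p \<in> F" "q \<in> F" "p \<noteq> q" for p q
  proof -
    have "r \<le> \<bar>p - q\<bar> / 2"
      unfolding r_def using fin that by (intro Min_le) (auto intro!: image_eqI[of _ _ "(p, q)"])
    then show ?thesis by simp
  qed
  \<comment> \<open>Radii \<open>s / k\<close> with \<open>s \<notin> C\<close> put no foot on the boundary of an annulus.\<close>
  define C where "C = range (\<lambda>(k :: nat, z, w). real k * \<bar>foot z - foot w\<bar>)"
  have "countable C" unfolding C_def by (rule countable_image) simp
  then have "uncountable ({0<..<r} - C)"
    using r uncountable_open_interval[of 0 r] by (intro uncountable_minus_countable) auto
  then obtain s where "s \<in> {0<..<r} - C" by (metis countable_empty equals0I)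
  then have s: "0 < s" "s < r" "s \<notin> C" by auto
  \<comment> \<open>The annulus s / (m + 2) < \<bar>x - p\<bar> < s / (m + 1), cleared of
    denominators; m = 0 has outer radius \<open>s\<close>.\<close>
  define An where "An p m = {x. s < real (m + 2) * \<bar>x - p\<bar> \<and> real (m + 1) * \<bar>x - p\<bar> < s}" for p m
  have An_open: "open (An p m)" for p m
    unfolding An_def by (intro open_Collect_conj open_Collect_less continuous_intros)
  have An_near: "\<bar>x - p\<bar> < s" "x \<noteq> p" if "x \<in> An p m" for x p m
  proof -
    have "\<bar>x - p\<bar> \<le> real (m + 1) * \<bar>x - p\<bar>" by (simp add: mult_le_cancel_right1)
    then show "\<bar>x - p\<bar> < s" using that by (simp add: An_def)
    show "x \<noteq> p" using that s(1) by (auto simp: An_def)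
  qed
  have close: "p = q" if "\<bar>x - p\<bar> < s" "\<bar>x - q\<bar> < s" "p \<in> F" "q \<in> F" for x p q
    using far[of p q] that s(2) by (cases "p = q") auto
  have An_le: "m \<le> n" if "s < real (n + 2) * \<bar>x - p\<bar>" "real (m + 1) * \<bar>x - p\<bar> < s" for x p m n
  proof -
    have "real (m + 1) * \<bar>x - p\<bar> < real (n + 2) * \<bar>x - p\<bar>" using that by simp
    then have "real (m + 1) < real (n + 2)" by (simp only: mult_less_cancel_right)
    then show ?thesis by simp
  qed
  have An_cover: "\<exists>m. foot z \<in> An p m" if z: "\<bar>foot z - p\<bar> < s" "foot z \<noteq> p" "p \<in> F" for z p
  proof -
    obtain w where w: "p = foot w" using F_foot z(3) by blast
    define d where "d = \<bar>foot z - p\<bar>"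
    have d: "0 < d" "d < s" using z by (auto simp: d_def)
    \<comment> \<open>The first annulus with inner radius below \<open>d\<close>. By minimality, or
      by \<open>d < s\<close> when m = 0, \<open>d\<close> does not exceed the outer radius;
      equality is ruled out by \<open>s \<notin> C\<close>.\<close>
    define m where "m = (LEAST m. s < real (m + 2) * d)"
    obtain k where "s < real k * d" using reals_Archimedean3[OF d(1)] by blast
    then have ex: "s < real (k + 2) * d" using d by (simp add: algebra_simps)
    then have m: "s < real (m + 2) * d" unfolding m_def by (rule LeastI)
    have "real (m + 1) * d \<le> s"
    proof (cases m)
      case (Suc n)
      then have "\<not> s < real (n + 2) * d" using not_less_Least[of n "\<lambda>m. s < real (m + 2) * d"] unfolding m_def by simp
      then show ?thesis using Suc by simp
    qed (use d in simp)
    moreover have "real (m + 1) * d \<noteq> s"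
    proof
      assume "real (m + 1) * d = s"
      then have "s = (\<lambda>(k :: nat, z, w). real k * \<bar>foot z - foot w\<bar>) (m + 1, z, w)"
        by (simp add: d_def w)
      then show False using s(3) unfolding C_def by blast
    qed
    ultimately show ?thesis using m by (auto simp: An_def d_def)
  qed
  obtain i0 where i0: "i0 \<in> I" using \<open>I \<noteq> {}\<close> by blast
  define rest where "rest = {x. \<forall>p\<in>F. s < \<bar>x - p\<bar>}"
  have rest_open: "open rest"
  proof -
    have "rest = (\<Inter>p\<in>F. {x. s < \<bar>x - p\<bar>})" by (auto simp: rest_def)
    then show ?thesis using F by (auto intro!: open_INT open_Collect_less continuous_intros)
  qed
  \<comment> \<open>The remainder \<open>rest\<close> needs some label; index 0 keeps it out of the
    limit m \<rightarrow> \<infinity>.\<close>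
  define U where "U = (\<lambda>(i, m). if i \<in> I then (\<Union>p\<in>\<Phi> i. An p m) \<union>
    (if i = i0 \<and> m = 0 then rest else {}) else {})"
  have U_cases: "i \<in> I \<and> ((\<exists>p\<in>\<Phi> i. x \<in> An p m) \<or> i = i0 \<and> m = 0 \<and> x \<in> rest)" if "x \<in> U (i, m)" for x i m
    using that by (auto simp: U_def split: if_splits)
  have An_U: "x \<in> U (i, m)" if "i \<in> I" "p \<in> \<Phi> i" "x \<in> An p m" for x i m p
    using that by (auto simp: U_def)
  have \<Phi>_F: "p \<in> F" if "i \<in> I" "p \<in> \<Phi> i" for i p
    using that by (auto simp: F_def)
  have An_rest: False if "x \<in> An p m" "p \<in> F" "x \<in> rest" for x p m
    using An_near(1)[OF that(1)] that by (auto simp: rest_def)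
  have 1: "open (U l)" for l
    using An_open rest_open by (cases l) (auto simp: U_def)
  have 2: "U l = {} \<longleftrightarrow> fst l \<notin> I" for l
  proof -
    obtain i m where l: "l = (i, m)" by (cases l)
    have "U l \<noteq> {}" if "i \<in> I"
    proof -
      \<comment> \<open>The denominator m + 3 / 2 lies between those of the two radii.\<close>
      define t where "t = s / (real m + 3 / 2)"
      have "(real m + 3 / 2) * t = s" by (simp add: t_def)
      moreover have "t > 0" using s(1) by (simp add: t_def)
      ultimately have "foot (a i) + t \<in> An (foot (a i)) m"
        by (simp add: An_def distrib_right)
      then show ?thesis using An_U[OF that] l by (auto simp: \<Phi>_def)
    qed
    then show ?thesis by (auto simp: U_def l)
  qed
  have 3: "l = l'" if "x \<in> U l" "x \<in> U l'" for l l' x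
  proof -
    obtain i m j n where l: "l = (i, m)" "l' = (j, n)" by (cases l; cases l')
    have An_eq: "i = j \<and> m = n"
      if An: "i \<in> I" "j \<in> I" "p \<in> \<Phi> i" "q \<in> \<Phi> j" "x \<in> An p m" "x \<in> An q n" for p q
    proof -
      have "p = q" using close An_near(1) An \<Phi>_F by metis
      moreover have "m = n"
        using An An_le[of n x p m] An_le[of m x p n] unfolding \<open>p = q\<close> by (simp add: An_def)
      ultimately show ?thesis using \<Phi>_disjoint An by blast
    qed
    have no_rest: False if "i \<in> I" "p \<in> \<Phi> i" "x \<in> An p m" "x \<in> rest" for i p m
      using that An_rest \<Phi>_F by blast
    have "i \<in> I \<and> ((\<exists>p\<in>\<Phi> i. x \<in> An p m) \<or> i = i0 \<and> m = 0 \<and> x \<in> rest)"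
      "j \<in> I \<and> ((\<exists>p\<in>\<Phi> j. x \<in> An p n) \<or> j = i0 \<and> n = 0 \<and> x \<in> rest)"
      using that unfolding l by (auto dest!: U_cases)
    then show ?thesis
      unfolding l by (elim conjE disjE bexE) (use An_eq no_rest in blast)+
  qed
  have 4: "(\<exists>l. foot z \<in> U l) \<longleftrightarrow> upper z \<notin> a ` I" for z
  proof
    assume "\<exists>l. foot z \<in> U l"
    then obtain i m where "foot z \<in> U (i, m)" by (metis surj_pair)
    then consider p where "p \<in> F" "foot z \<in> An p m" | "foot z \<in> rest"
      using U_cases \<Phi>_F by blast
    then have "foot z \<notin> F"
    proof cases
      case 1
      then show ?thesis using An_near[OF 1(2)] close[of "foot z" "foot z" p] s(1) by auto
    next
      case 2
      then show ?thesis using s(1) by (auto simp: rest_def)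
    qed
    then show "upper z \<notin> a ` I" using F_iff by blast
  next
    assume "upper z \<notin> a ` I"
    then have z: "foot z \<notin> F" using F_iff by blast
    show "\<exists>l. foot z \<in> U l"
    proof (cases "\<exists>p\<in>F. \<bar>foot z - p\<bar> < s")
      case True
      then obtain i p where ip: "i \<in> I" "p \<in> \<Phi> i" "\<bar>foot z - p\<bar> < s" by (auto simp: F_def)
      moreover have "foot z \<noteq> p" using z ip \<Phi>_F by blast
      ultimately show ?thesis using An_cover An_U \<Phi>_F by metis
    next
      case False
      \<comment> \<open>The distance \<open>s\<close> is excluded by the factor k = 1 in
        \<open>C\<close>, so no foot falls between the annuli and \<open>rest\<close>.\<close>
      have "\<bar>foot z - p\<bar> \<noteq> s" if p: "p \<in> F" for p
      proof
        assume eq: "\<bar>foot z - p\<bar> = s"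
        obtain w where "p = foot w" using F_foot p by blast
        then have "s = (\<lambda>(k :: nat, z, w). real k * \<bar>foot z - foot w\<bar>) (1, z, w)"
          using eq by simp
        then show False using s(3) unfolding C_def by blast
      qed
      then have "foot z \<in> rest" using False by (force simp: rest_def)
      then have "foot z \<in> U (i0, 0)" using i0 by (simp add: U_def)
      then show ?thesis by blast
    qed
  qed
  have 5: "\<exists>d>0. \<forall>z. upper z \<noteq> a i \<longrightarrow> near d (a i) (foot z) \<longrightarrow> (\<exists>m\<ge>N. foot z \<in> U (i, m))"
    if i: "i \<in> I" for i N
  proof (intro exI[of _ "s / real (N + 1)"] conjI allI impI)
    \<comment> \<open>This is the outer radius of annulus number \<open>N\<close>, so closer points
      have index at least \<open>N\<close>.\<close>
    show "0 < s / real (N + 1)" using s by simp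
    fix z assume z: "upper z \<noteq> a i" and "near (s / real (N + 1)) (a i) (foot z)"
    then obtain p where p: "p \<in> \<Phi> i" "\<bar>foot z - p\<bar> < s / real (N + 1)"
      by (auto simp: near_def \<Phi>_def)
    then have N: "real (N + 1) * \<bar>foot z - p\<bar> < s"
      by (simp add: pos_less_divide_eq mult.commute)
    have "s / real (N + 1) \<le> s" using s(1) by (simp add: field_simps)
    then have "\<bar>foot z - p\<bar> < s" using p by simp
    moreover have "foot z \<noteq> p" using \<Phi>_iff[OF i] z p by blast
    ultimately obtain m where m: "foot z \<in> An p m" using An_cover \<Phi>_F i p by blast
    then have "N \<le> m" using N by (intro An_le[of m "foot z" p N]) (auto simp: An_def)
    then show "\<exists>m\<ge>N. foot z \<in> U (i, m)" using An_U[OF i p(1) m] by blast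
  qed
  have 6: "\<exists>N. \<forall>m\<ge>N. \<forall>x\<in>U (i, m). near e (a i) x" if i: "i \<in> I" "e > 0" for i e
  proof -
    obtain N where N: "s < real N * e" using reals_Archimedean3[OF \<open>e > 0\<close>] by blast
    \<comment> \<open>Starting at \<open>N + 1\<close> excludes m = 0 and with it
      \<open>rest\<close>.\<close>
    have "near e (a i) x" if m: "m \<ge> N + 1" "x \<in> U (i, m)" for m x
    proof -
      obtain p where p: "p \<in> \<Phi> i" "x \<in> An p m" using U_cases[OF m(2)] m(1) by auto
      have "real (m + 1) * \<bar>x - p\<bar> < real N * e" using p N by (simp add: An_def)
      also have "\<dots> \<le> real (m + 1) * e" using m \<open>e > 0\<close> by (intro mult_right_mono) auto
      finally have "\<bar>x - p\<bar> < e" by (simp only: mult_less_cancel_left)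
      then show ?thesis using p(1) by (auto simp: near_def \<Phi>_def)
    qed
    then show ?thesis by blast
  qed
  have "star_cover I a U"
    unfolding star_cover_def
    by (intro conjI allI ballI impI) (rule 1 2 4 | erule 5 | erule (1) 3 6)+
  then show thesis using that by blast
qed

theorem corollary1:
  fixes n :: nat
  assumes "n > 0"
  shows "n_homogeneous n bing_space"
  unfolding n_homogeneous_def topspace_bing_space
proof (intro allI impI, elim conjE)
  fix A B and f :: "rat \<times> rat \<Rightarrow> rat \<times> rat"
  assume A: "A \<subseteq> bing_set" "finite A" "card A = n" and B: "B \<subseteq> bing_set"
    and f: "bij_betw f A B"
  have "A \<noteq> {}" using A assms by auto
  have f': "inj_on f A" "f ` A \<subseteq> bing_set" using f B by (auto simp: bij_betw_def)
  \<comment> \<open>\<open>A\<close> itself is the index set of both covers: the identity enumerates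
    \<open>A\<close> and \<open>f\<close> enumerates \<open>B\<close>, so the homeomorphism extends
    \<open>f\<close>.\<close>
  obtain U where "star_cover A (\<lambda>x. x) U"
    using star_cover_exists[of A "\<lambda>x. x"] A \<open>A \<noteq> {}\<close> by auto
  moreover obtain V where "star_cover A f V"
    using star_cover_exists[of A f] A \<open>A \<noteq> {}\<close> f' by auto
  ultimately show "\<exists>h. homeomorphic_map bing_space bing_space h \<and> (\<forall>x\<in>A. h x = f x)"
    using homeomorphic_map_star[of A "\<lambda>x. x" U f V] f' A(1) by auto
qed

end
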